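(* Let $G$ be a finitely generated group. Assume that $G$ acts by homeomorphisms $g\mapsto\Phi_g$ on a compact Hausdorff space $X$, and that $\nu$ is a Borel probability measure on $X$ whose measure class is preserved by the action, with Radon-Nikodym derivatives $\rho_g=\frac{dg^*\nu}{d\nu}$ ($g\in G$), where $\rho_s\in L_\infty(X,\nu)$ for every $s$ in a fixed finite symmetric generating set $S$ of $G$. Put $\overline{\rho}(x)=\sup_{g\in G}\rho_g(x)$ and $\underline{\rho}(x)=\inf_{g\in G}\rho_g(x)$. Suppose that at least one of the following conditions holds: \begin{enumerate} \item $\overline{\rho}\in L_1(X,\nu)$; \item $\int_X\underline{\rho}(x)\,d\nu>0$. \end{enumerate} If the action of $G$ on $X$ is topologically amenable, then $G$ admits a metrically proper affine isometric action on a Hilbert space.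
   Context: Let $S$ be a finite symmetric ($S=S^{-1}$) generating set of $G$ and let $|\cdot|$ be the associated word length function. Radon-Nikodym derivatives: for $f:X\to\mathbb{R}$ write $(g*f)(x)=f(\Phi_{g^{-1}}(x))$. The measure $g^*\nu$ is the translate $g^*\nu(E)=\nu(\Phi_{g^{-1}}(E))$. That the measure class is preserved means that $g^*\nu$ and $\nu$ are mutually absolutely continuous for every $g\in G$. The derivative $\rho_g=dg^*\nu/d\nu$ thus satisfies $\int_X (g*f)\,\rho_g\,d\nu=\int_X f\,d\nu$. Topological amenability: let $\mathbb{F}$ be the space of functions $\xi:G\to C(X)$, $g\mapsto\xi_g$, with $\xi_g=0$ for all but finitely many $g$. For $\xi,\eta\in\mathbb{F}$ put $\langle\xi,\eta\rangle_{C(X)}(x)=\sum_{g\in G}\xi_g(x)\eta_g(x)$ and $(L_g\xi)_h(x)=\xi_{g^{-1}h}(\Phi_{g^{-1}}(x))$. The action of $G$ on $X$ is topologically amenable if for every $\varepsilon>0$ there is $\xi\in\mathbb{F}$ such that (a) $\xi_g\ge 0$ for every $g\in G$; (b) $\langle\xi,\xi\rangle_{C(X)}=1_X$; (c) $\sup_{x\in X}\left(1-\frac{1}{\#S}\sum_{s\in S}\langle\xi,L_s\xi\rangle_{C(X)}(x)\right)\le\varepsilon$. (This does not depend on the choice of $S$.) Affine isometric actions: an affine isometric action of $G$ on a Banach space $E$ is an action of the form $A_gv=\pi_gv+b_g$, where $\pi$ is a representation of $G$ by linear (surjective) isometries of $E$ and $b:G\to E$ satisfies $b_{gh}=\pi_gb_h+b_g$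 for all $g,h\in G$. It is metrically proper if $\lim_{|g|\to\infty}\|A_gv\|=\infty$ for every $v\in E$, equivalently $\lim_{|g|\to\infty}\|b_g\|=\infty$. *)

theory Defs
  imports "HOL-Probability.Probability" "HOL-Algebra.Algebra" "HOL-Algebra.Algebraic_Closure_Type"
begin

definition symmetric_generating_set :: "('g, 'm) monoid_scheme \<Rightarrow> 'g set \<Rightarrow> bool" where
  "symmetric_generating_set G S \<longleftrightarrow>
     finite S \<and> S \<subseteq> carrier G \<and> m_inv G ` S = S \<and> generate G S = carrier G"

definition word_length :: "('g, 'm) monoid_scheme \<Rightarrow> 'g set \<Rightarrow> 'g \<Rightarrow> nat" where
  "word_length G S g =
     (LEAST n. \<exists>ws. set ws \<subseteq> S \<and> length ws = n \<and> foldr (mult G) ws (one G) = g)"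

definition action_by_homeomorphisms ::
    "('g, 'm) monoid_scheme \<Rightarrow> ('g \<Rightarrow> 'x::topological_space \<Rightarrow> 'x) \<Rightarrow> bool" where
  "action_by_homeomorphisms G \<Phi> \<longleftrightarrow>
     group_action G UNIV \<Phi> \<and> (\<forall>g\<in>carrier G. homeomorphic_map euclidean euclidean (\<Phi> g))"

(* As \<Phi> g is a bijection with inverse \<Phi> (inv g), this push-forward maps a Borel set E
   to \<nu> (\<Phi> (inv g) ` E). *)
definition translate_measure ::
    "('g \<Rightarrow> 'x::topological_space \<Rightarrow> 'x) \<Rightarrow> 'x measure \<Rightarrow> 'g \<Rightarrow> 'x measure" where
  "translate_measure \<Phi> \<nu> g = distr \<nu> borel (\<Phi> g)"

definition measure_class_preserved ::
    "('g, 'm) monoid_scheme \<Rightarrow> ('g \<Rightarrow> 'x::topological_space \<Rightarrow> 'x) \<Rightarrow> 'x measure \<Rightarrow> bool" where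
  "measure_class_preserved G \<Phi> \<nu> \<longleftrightarrow>
     (\<forall>g\<in>carrier G. absolutely_continuous \<nu> (translate_measure \<Phi> \<nu> g) \<and>
                    absolutely_continuous (translate_measure \<Phi> \<nu> g) \<nu>)"

definition rho :: "('g \<Rightarrow> 'x::topological_space \<Rightarrow> 'x) \<Rightarrow> 'x measure \<Rightarrow> 'g \<Rightarrow> 'x \<Rightarrow> ennreal" where
  "rho \<Phi> \<nu> g = RN_deriv \<nu> (translate_measure \<Phi> \<nu> g)"

definition rho_sup ::
    "('g, 'm) monoid_scheme \<Rightarrow> ('g \<Rightarrow> 'x::topological_space \<Rightarrow> 'x) \<Rightarrow> 'x measure \<Rightarrow> 'x \<Rightarrow> ennreal" where
  "rho_sup G \<Phi> \<nu> x = (SUP g\<in>carrier G. rho \<Phi> \<nu> g x)"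

definition rho_inf ::
    "('g, 'm) monoid_scheme \<Rightarrow> ('g \<Rightarrow> 'x::topological_space \<Rightarrow> 'x) \<Rightarrow> 'x measure \<Rightarrow> 'x \<Rightarrow> ennreal" where
  "rho_inf G \<Phi> \<nu> x = (INF g\<in>carrier G. rho \<Phi> \<nu> g x)"

definition fin_supp_maps :: "('g, 'm) monoid_scheme \<Rightarrow> ('g \<Rightarrow> 'x::topological_space \<Rightarrow> real) set" where
  "fin_supp_maps G =
     {\<xi>. (\<forall>g\<in>carrier G. continuous_on UNIV (\<xi> g)) \<and> finite {g \<in> carrier G. \<xi> g \<noteq> (\<lambda>_. 0)}}"

(* sum' sums over the nonzero terms, of which there are finitely many for \<xi>, \<eta> in fin_supp_maps G. *)
definition CX_inner ::
    "('g, 'm) monoid_scheme \<Rightarrow> ('g \<Rightarrow> 'x \<Rightarrow> real) \<Rightarrow> ('g \<Rightarrow> 'x \<Rightarrow> real) \<Rightarrow> 'x \<Rightarrow> real" where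
  "CX_inner G \<xi> \<eta> x = sum' (\<lambda>g. \<xi> g x * \<eta> g x) (carrier G)"

definition left_translate ::
    "('g, 'm) monoid_scheme \<Rightarrow> ('g \<Rightarrow> 'x \<Rightarrow> 'x) \<Rightarrow> 'g \<Rightarrow> ('g \<Rightarrow> 'x \<Rightarrow> real) \<Rightarrow> ('g \<Rightarrow> 'x \<Rightarrow> real)" where
  "left_translate G \<Phi> g \<xi> = (\<lambda>h x. \<xi> (m_inv G g \<otimes>\<^bsub>G\<^esub> h) (\<Phi> (m_inv G g) x))"

definition topologically_amenable ::
    "('g, 'm) monoid_scheme \<Rightarrow> 'g set \<Rightarrow> ('g \<Rightarrow> 'x::topological_space \<Rightarrow> 'x) \<Rightarrow> bool" where
  "topologically_amenable G S \<Phi> \<longleftrightarrow>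
     (\<forall>\<epsilon>>0. \<exists>\<xi>\<in>fin_supp_maps G.
        (\<forall>g\<in>carrier G. \<forall>x. \<xi> g x \<ge> 0) \<and>
        (\<forall>x. CX_inner G \<xi> \<xi> x = 1) \<and>
        (SUP x. 1 - 1 / real (card S) * (\<Sum>s\<in>S. CX_inner G \<xi> (left_translate G \<Phi> s \<xi>) x)) \<le> \<epsilon>)"

(* Hilbert spaces with an explicit carrier, so that one can quantify existentially over them.
   They are modules over the field of reals together with an inner product; the multiplicative
   fields (mult, one) that the module record inherits from rings play no role. *)
record 'v hilbert = "(real, 'v) module" +
  ip :: "'v \<Rightarrow> 'v \<Rightarrow> real"

definition hnorm :: "('v, 'm) hilbert_scheme \<Rightarrow> 'v \<Rightarrow> real" where
  "hnorm E v = sqrt (ip E v v)"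

definition hdist :: "('v, 'm) hilbert_scheme \<Rightarrow> 'v \<Rightarrow> 'v \<Rightarrow> real" where
  "hdist E v w = hnorm E (v \<ominus>\<^bsub>E\<^esub> w)"

(* Completeness is spelled out: the library notion mcomplete requires a metric that is symmetric
   and nonnegative also outside the carrier. *)
locale real_hilbert_space = Module.module "ring_of_type_algebra :: real ring" E
  for E :: "('v, 'm) hilbert_scheme" (structure) +
  assumes ip_commute: "\<lbrakk>v \<in> carrier E; w \<in> carrier E\<rbrakk> \<Longrightarrow> ip E v w = ip E w v"
    and ip_add: "\<lbrakk>u \<in> carrier E; v \<in> carrier E; w \<in> carrier E\<rbrakk> \<Longrightarrow>
                   ip E (u \<oplus> v) w = ip E u w + ip E v w"
    and ip_smult: "\<lbrakk>v \<in> carrier E; w \<in> carrier E\<rbrakk> \<Longrightarrow> ip E (a \<odot> v) w = a * ip E v w"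
    and ip_nonneg: "v \<in> carrier E \<Longrightarrow> ip E v v \<ge> 0"
    and ip_definite: "\<lbrakk>v \<in> carrier E; ip E v v = 0\<rbrakk> \<Longrightarrow> v = \<zero>"
    and complete:
      "\<lbrakk>range s \<subseteq> carrier E;
        \<forall>\<epsilon>>0. \<exists>N::nat. \<forall>m\<ge>N. \<forall>n\<ge>N. hdist E (s m) (s n) < \<epsilon>\<rbrakk> \<Longrightarrow>
       \<exists>v\<in>carrier E. (\<lambda>n. hdist E (s n) v) \<longlonglongrightarrow> 0"

definition linear_isometry :: "('v, 'm) hilbert_scheme \<Rightarrow> ('v \<Rightarrow> 'v) \<Rightarrow> bool" where
  "linear_isometry E T \<longleftrightarrow>
     T ` carrier E = carrier E \<and>
     (\<forall>v\<in>carrier E. \<forall>w\<in>carrier E. T (v \<oplus>\<^bsub>E\<^esub> w) = T v \<oplus>\<^bsub>E\<^esub> T w) \<and>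
     (\<forall>a. \<forall>v\<in>carrier E. T (a \<odot>\<^bsub>E\<^esub> v) = a \<odot>\<^bsub>E\<^esub> T v) \<and>
     (\<forall>v\<in>carrier E. hnorm E (T v) = hnorm E v)"

definition isometric_representation ::
    "('g, 'm) monoid_scheme \<Rightarrow> ('v, 'n) hilbert_scheme \<Rightarrow> ('g \<Rightarrow> 'v \<Rightarrow> 'v) \<Rightarrow> bool" where
  "isometric_representation G E \<pi> \<longleftrightarrow>
     (\<forall>g\<in>carrier G. linear_isometry E (\<pi> g)) \<and>
     (\<forall>v\<in>carrier E. \<pi> \<one>\<^bsub>G\<^esub> v = v) \<and>
     (\<forall>g\<in>carrier G. \<forall>h\<in>carrier G. \<forall>v\<in>carrier E. \<pi> (g \<otimes>\<^bsub>G\<^esub> h) v = \<pi> g (\<pi> h v))"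

definition affine_isometric_action ::
    "('g, 'm) monoid_scheme \<Rightarrow> ('v, 'n) hilbert_scheme \<Rightarrow> ('g \<Rightarrow> 'v \<Rightarrow> 'v) \<Rightarrow> bool" where
  "affine_isometric_action G E A \<longleftrightarrow>
     (\<exists>\<pi> b. isometric_representation G E \<pi> \<and>
        b \<in> carrier G \<rightarrow> carrier E \<and>
        (\<forall>g\<in>carrier G. \<forall>h\<in>carrier G. b (g \<otimes>\<^bsub>G\<^esub> h) = \<pi> g (b h) \<oplus>\<^bsub>E\<^esub> b g) \<and>
        (\<forall>g\<in>carrier G. \<forall>v\<in>carrier E. A g v = \<pi> g v \<oplus>\<^bsub>E\<^esub> b g))"

definition metrically_proper ::
    "('g, 'm) monoid_scheme \<Rightarrow> 'g set \<Rightarrow> ('v, 'n) hilbert_scheme \<Rightarrow> ('g \<Rightarrow> 'v \<Rightarrow> 'v) \<Rightarrow> bool" where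
  "metrically_proper G S E A \<longleftrightarrow>
     (\<forall>v\<in>carrier E. filterlim (\<lambda>g. hnorm E (A g v)) at_top
        (inf (filtercomap (word_length G S) at_top) (principal (carrier G))))"

(* HOL cannot quantify existentially over types, so the carrier is a subset of the fixed type
   nat \<Rightarrow> real, with arbitrary operations. This loses no generality for a countable group: the
   closed linear span of the values of the cocycle b is invariant and separable, so it has at
   most continuum many elements and can be transported to a subset of nat \<Rightarrow> real. *)
definition has_proper_affine_isometric_action_on_hilbert_space ::
    "('g, 'm) monoid_scheme \<Rightarrow> 'g set \<Rightarrow> bool" where
  "has_proper_affine_isometric_action_on_hilbert_space G S \<longleftrightarrow>
     (\<exists>(E :: (nat \<Rightarrow> real) hilbert) A.
        real_hilbert_space E \<and> affine_isometric_action G E A \<and> metrically_proper G S E A)"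

end

theory Submission
  imports Defs
begin

text \<open>
  The cocycle identity \<open>\<rho>\<^bsub>gh\<^esub>(x) = \<rho>\<^sub>g(x) \<rho>\<^sub>h(g\<inverse>x)\<close> shows that
  \<open>\<rho>\<^sub>g(x) w(g\<inverse>x) = w(x)\<close> almost everywhere both for the supremum and for the infimum \<open>w\<close> of the
  derivatives. Under either integrability condition \<open>w \<nu>\<close> is therefore, up to normalisation, a
  \<open>G\<close>-invariant probability measure \<open>\<mu>\<close>. If \<open>\<xi>\<close> witnesses topological amenability for a small
  \<open>\<epsilon>\<close>, then \<open>f(h) = (\<integral> \<xi>\<^sub>h\<^sup>2 d\<mu>)\<^sup>1\<^sup>/\<^sup>2\<close> is a finitely supported almost invariant unit vector
  of \<open>\<ell>\<^sup>2(G)\<close>. Following Bekka, Cherix and Valette, choose such vectors \<open>f\<^sub>n\<close> with summable defects: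
  the formal coboundary of \<open>\<Oplus> f\<^sub>n\<close> is an honest cocycle with values in \<open>\<ell>\<^sup>2(\<nat> \<times> G)\<close>, and its
  \<open>n\<close>-th component has norm at least 1 as soon as \<open>g\<close> moves the support of \<open>f\<^sub>n\<close> off itself.
\<close>

subsection \<open>The sequence space as a Hilbert space with explicit carrier\<close>

text \<open>The carrier has to lie in \<open>nat \<Rightarrow> real\<close>, so the Hilbert space
  l^2(N x G) is later realised here through an enumeration of its index set.\<close>

definition l2 :: "(nat \<Rightarrow> real) hilbert" where
  "l2 = \<lparr>carrier = {v. (\<lambda>i. (v i)\<^sup>2) summable_on UNIV}, monoid.mult = \<lambda>_ _ _. 0, monoid.one = \<lambda>_. 0,
         ring.zero = \<lambda>_. 0, ring.add = \<lambda>v w i. v i + w i, module.smult = \<lambda>a v i. a * v i,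
         hilbert.ip = \<lambda>v w. \<Sum>\<^sub>\<infinity>i. v i * w i\<rparr>"

lemma l2_simps [simp]:
  "v \<in> carrier l2 \<longleftrightarrow> (\<lambda>i. (v i)\<^sup>2) summable_on UNIV"
  "\<zero>\<^bsub>l2\<^esub> = (\<lambda>_. 0)" "v \<oplus>\<^bsub>l2\<^esub> w = (\<lambda>i. v i + w i)" "a \<odot>\<^bsub>l2\<^esub> v = (\<lambda>i. a * v i)"
  "ip l2 v w = (\<Sum>\<^sub>\<infinity>i. v i * w i)"
  by (simp_all add: l2_def)

lemma square_add_le: "((a::real) + b)\<^sup>2 \<le> 2 * a\<^sup>2 + 2 * b\<^sup>2"
  using zero_le_power2[of "a - b"] by (simp add: power2_eq_square algebra_simps)

text \<open>A crude substitute for the Minkowski inequality: the constant 2 is harmless both for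
  summability and for properness estimates.\<close>

lemma square_summable_add:
  fixes v w :: "'i \<Rightarrow> real"
  assumes "(\<lambda>i. (v i)\<^sup>2) summable_on A" "(\<lambda>i. (w i)\<^sup>2) summable_on A"
  shows "(\<lambda>i. (v i + w i)\<^sup>2) summable_on A"
    and "(\<Sum>\<^sub>\<infinity>i\<in>A. (v i + w i)\<^sup>2) \<le> 2 * (\<Sum>\<^sub>\<infinity>i\<in>A. (v i)\<^sup>2) + 2 * (\<Sum>\<^sub>\<infinity>i\<in>A. (w i)\<^sup>2)"
proof -
  have s: "(\<lambda>i. 2 * (v i)\<^sup>2 + 2 * (w i)\<^sup>2) summable_on A"
    by (intro summable_on_add summable_on_cmult_right assms)
  show t: "(\<lambda>i. (v i + w i)\<^sup>2) summable_on A"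
    by (rule summable_on_comparison_test[OF s square_add_le]) simp
  have "(\<Sum>\<^sub>\<infinity>i\<in>A. (v i + w i)\<^sup>2) \<le> (\<Sum>\<^sub>\<infinity>i\<in>A. 2 * (v i)\<^sup>2 + 2 * (w i)\<^sup>2)"
    by (rule infsum_mono[OF t s square_add_le])
  also have "\<dots> = 2 * (\<Sum>\<^sub>\<infinity>i\<in>A. (v i)\<^sup>2) + 2 * (\<Sum>\<^sub>\<infinity>i\<in>A. (w i)\<^sup>2)"
    by (simp add: infsum_add summable_on_cmult_right assms infsum_cmult_right)
  finally show "(\<Sum>\<^sub>\<infinity>i\<in>A. (v i + w i)\<^sup>2) \<le> 2 * (\<Sum>\<^sub>\<infinity>i\<in>A. (v i)\<^sup>2) + 2 * (\<Sum>\<^sub>\<infinity>i\<in>A. (w i)\<^sup>2)" .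
qed

lemma square_summable_cmult:
  fixes v :: "'i \<Rightarrow> real"
  assumes "(\<lambda>i. (v i)\<^sup>2) summable_on A"
  shows "(\<lambda>i. (a * v i)\<^sup>2) summable_on A"
  unfolding power_mult_distrib by (rule summable_on_cmult_right[OF assms])

text \<open>Polarisation writes the product as half of a combination of squares; this makes the
  inner product well defined.\<close>

lemma square_summable_mult:
  fixes v w :: "'i \<Rightarrow> real"
  assumes "(\<lambda>i. (v i)\<^sup>2) summable_on A" "(\<lambda>i. (w i)\<^sup>2) summable_on A"
  shows "(\<lambda>i. v i * w i) summable_on A"
proof -
  have "(\<lambda>i. 1/2 * ((v i + w i)\<^sup>2 + (-1) * (v i)\<^sup>2 + (-1) * (w i)\<^sup>2)) summable_on A"
    by (intro summable_on_cmult_right summable_on_add square_summable_add assms)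
  thus ?thesis by (simp add: power2_eq_square algebra_simps)
qed

lemma abelian_group_l2: "abelian_group l2"
proof (rule abelian_groupI)
  fix v assume "v \<in> carrier l2"
  thus "\<exists>w\<in>carrier l2. w \<oplus>\<^bsub>l2\<^esub> v = \<zero>\<^bsub>l2\<^esub>"
    by (intro bexI[of _ "\<lambda>i. - v i"]) auto
qed (auto simp: square_summable_add fun_eq_iff)

lemma l2_minus: "v \<in> carrier l2 \<Longrightarrow> w \<in> carrier l2 \<Longrightarrow> v \<ominus>\<^bsub>l2\<^esub> w = (\<lambda>i. v i - w i)"
  using abelian_group.minus_equality[OF abelian_group_l2, of "\<lambda>i. - w i" w]
  by (simp add: a_minus_def)

lemma module_l2: "Module.module (ring_of_type_algebra :: real ring) l2"
  by (rule Module.moduleI[OF cring_from_type_algebra abelian_group_l2])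
     (auto simp: ring_of_type_algebra_def algebra_simps power_mult_distrib
           intro: summable_on_cmult_right)

text \<open>Coordinates converge because a single term is bounded by the whole sum. The Cauchy
  estimate passes to the limit in \<open>m\<close> on each finite \<open>K\<close>, where limit and
  sum commute, and the resulting uniform bound then extends to the infinite sum.\<close>

lemma square_summable_complete:
  fixes s :: "nat \<Rightarrow> 'i \<Rightarrow> real"
  assumes s: "\<And>n. (\<lambda>i. (s n i)\<^sup>2) summable_on A"
    and Cauchy: "\<And>e. e > 0 \<Longrightarrow> \<exists>N. \<forall>m\<ge>N. \<forall>n\<ge>N. (\<Sum>\<^sub>\<infinity>i\<in>A. (s m i - s n i)\<^sup>2) < e"
  obtains v where "(\<lambda>i. (v i)\<^sup>2) summable_on A" "(\<lambda>n. \<Sum>\<^sub>\<infinity>i\<in>A. (s n i - v i)\<^sup>2) \<longlonglongrightarrow> 0"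
proof -
  have sd: "(\<lambda>i. (s m i - s n i)\<^sup>2) summable_on A" for m n
    using square_summable_add(1)[OF s[of m] square_summable_cmult[OF s[of n], of "-1"]] by simp
  define v where "v i = lim (\<lambda>n. s n i)" for i
  have lim: "(\<lambda>n. s n i) \<longlonglongrightarrow> v i" if i: "i \<in> A" for i
  proof -
    have "Cauchy (\<lambda>n. s n i)"
    proof (rule metric_CauchyI)
      fix e :: real assume "e > 0"
      then obtain N where N: "\<And>m n. m \<ge> N \<Longrightarrow> n \<ge> N \<Longrightarrow> (\<Sum>\<^sub>\<infinity>i\<in>A. (s m i - s n i)\<^sup>2) < e\<^sup>2"
        using Cauchy[of "e\<^sup>2"] by auto
      have "dist (s m i) (s n i) < e" if "m \<ge> N" "n \<ge> N" for m n
      proof -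
        have "(s m i - s n i)\<^sup>2 \<le> (\<Sum>\<^sub>\<infinity>i\<in>A. (s m i - s n i)\<^sup>2)"
          using finite_sum_le_infsum[OF sd[of m n], of "{i}"] i by simp
        also have "\<dots> < e\<^sup>2" by (rule N[OF that])
        finally show ?thesis
          using \<open>e > 0\<close> power2_less_imp_less[of "\<bar>s m i - s n i\<bar>" e]
          by (simp add: dist_real_def)
      qed
      thus "\<exists>M. \<forall>m\<ge>M. \<forall>n\<ge>M. dist (s m i) (s n i) < e" by blast
    qed
    thus ?thesis unfolding v_def by (simp add: Cauchy_convergent_iff convergent_LIMSEQ_iff)
  qed
  have bound: "\<exists>N. \<forall>n\<ge>N. \<forall>K. finite K \<and> K \<subseteq> A \<longrightarrow> (\<Sum>i\<in>K. (s n i - v i)\<^sup>2) \<le> e" if e: "e > 0" for e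
  proof -
    obtain N where N: "\<And>m n. m \<ge> N \<Longrightarrow> n \<ge> N \<Longrightarrow> (\<Sum>\<^sub>\<infinity>i\<in>A. (s m i - s n i)\<^sup>2) < e"
      using Cauchy[OF e] by auto
    have "(\<Sum>i\<in>K. (s n i - v i)\<^sup>2) \<le> e" if n: "n \<ge> N" and K: "finite K" "K \<subseteq> A" for n K
    proof (rule LIMSEQ_le_const2)
      show "(\<lambda>m. \<Sum>i\<in>K. (s n i - s m i)\<^sup>2) \<longlonglongrightarrow> (\<Sum>i\<in>K. (s n i - v i)\<^sup>2)"
        using K by (intro tendsto_sum tendsto_power tendsto_diff tendsto_const lim) auto
      have "(\<Sum>i\<in>K. (s n i - s m i)\<^sup>2) \<le> e" if "m \<ge> N" for m
        using finite_sum_le_infsum[OF sd[of n m] K] N[OF n that] by force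
      thus "\<exists>M. \<forall>m\<ge>M. (\<Sum>i\<in>K. (s n i - s m i)\<^sup>2) \<le> e" by blast
    qed
    thus ?thesis by blast
  qed
  have sv: "(\<lambda>i. (s n i - v i)\<^sup>2) summable_on A" if "\<And>K. finite K \<Longrightarrow> K \<subseteq> A \<Longrightarrow> (\<Sum>i\<in>K. (s n i - v i)\<^sup>2) \<le> e" for n e
    by (rule nonneg_bdd_above_summable_on) (use that in \<open>auto simp: bdd_above_def\<close>)
  show thesis
  proof (rule that)
    obtain N where "\<And>K. finite K \<Longrightarrow> K \<subseteq> A \<Longrightarrow> (\<Sum>i\<in>K. (s N i - v i)\<^sup>2) \<le> 1"
      using bound[of 1] by auto
    from square_summable_add(1)[OF s[of N] square_summable_cmult[OF sv[OF this], of "-1"]]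
    show "(\<lambda>i. (v i)\<^sup>2) summable_on A" by simp
    show "(\<lambda>n. \<Sum>\<^sub>\<infinity>i\<in>A. (s n i - v i)\<^sup>2) \<longlonglongrightarrow> 0"
    proof (rule metric_LIMSEQ_I)
      fix e :: real assume e: "e > 0"
      then obtain N where N: "\<And>n K. n \<ge> N \<Longrightarrow> finite K \<Longrightarrow> K \<subseteq> A \<Longrightarrow> (\<Sum>i\<in>K. (s n i - v i)\<^sup>2) \<le> e/2"
        using bound[of "e/2"] by auto
      have "(\<Sum>\<^sub>\<infinity>i\<in>A. (s n i - v i)\<^sup>2) \<le> e/2" if "n \<ge> N" for n
        by (rule infsum_le_finite_sums[OF sv[OF N[OF that]]]) (use N that in auto)
      moreover have "(\<Sum>\<^sub>\<infinity>i\<in>A. (s n i - v i)\<^sup>2) \<ge> 0" for n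
        by (rule infsum_nonneg) simp
      ultimately show "\<exists>M. \<forall>n\<ge>M. dist (\<Sum>\<^sub>\<infinity>i\<in>A. (s n i - v i)\<^sup>2) 0 < e"
        using e by (intro exI[of _ N]) (force simp: dist_real_def)
    qed
  qed
qed

lemma hnorm_l2: "hnorm l2 v = sqrt (\<Sum>\<^sub>\<infinity>i. (v i)\<^sup>2)"
  by (simp add: hnorm_def power2_eq_square)

lemma real_hilbert_space_l2: "real_hilbert_space l2"
proof (intro real_hilbert_space.intro module_l2 real_hilbert_space_axioms.intro)
  fix v assume v: "v \<in> carrier l2" and "ip l2 v v = 0"
  hence "(v i)\<^sup>2 \<le> 0" for i
    using finite_sum_le_infsum[of "\<lambda>i. (v i)\<^sup>2" UNIV "{i}"] by (simp add: power2_eq_square)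
  thus "v = \<zero>\<^bsub>l2\<^esub>" by auto
next
  fix s :: "nat \<Rightarrow> nat \<Rightarrow> real"
  assume s: "range s \<subseteq> carrier l2"
    and C: "\<forall>e>0. \<exists>N::nat. \<forall>m\<ge>N. \<forall>n\<ge>N. hdist l2 (s m) (s n) < e"
  have s': "s n \<in> carrier l2" for n using s by (rule subsetD) simp
  have "\<exists>N. \<forall>m\<ge>N. \<forall>n\<ge>N. (\<Sum>\<^sub>\<infinity>i. (s m i - s n i)\<^sup>2) < e" if "e > 0" for e
    using C[rule_format, of "sqrt e"] that by (simp add: hdist_def l2_minus[OF s' s'] hnorm_l2)
  then obtain v where v: "(\<lambda>i. (v i)\<^sup>2) summable_on UNIV"
      "(\<lambda>n. \<Sum>\<^sub>\<infinity>i. (s n i - v i)\<^sup>2) \<longlonglongrightarrow> 0"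
    by (rule square_summable_complete[of s UNIV, rotated]) (use s' in auto)
  have "(\<lambda>n. hdist l2 (s n) v) \<longlonglongrightarrow> 0"
    using tendsto_real_sqrt[OF v(2)] v(1) by (simp add: hdist_def l2_minus[OF s'] hnorm_l2)
  thus "\<exists>v\<in>carrier l2. (\<lambda>n. hdist l2 (s n) v) \<longlonglongrightarrow> 0" using v(1) by auto
qed (auto simp: mult.commute algebra_simps infsum_add square_summable_mult infsum_cmult_right
       intro: infsum_nonneg)

section \<open>Affine isometric actions from formal coboundaries\<close>

text \<open>Here \<open>F\<close> need not be square summable, so the cocycle is only a formal coboundary; \<open>P g\<close> is the
  permutation by which \<open>g\<inverse>\<close> moves the indices.\<close>

lemma coboundary_action:
  fixes G :: "('g, 'm) monoid_scheme" and P :: "'g \<Rightarrow> nat \<Rightarrow> nat" and F :: "nat \<Rightarrow> real"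
  assumes bij: "\<And>g. g \<in> carrier G \<Longrightarrow> bij (P g)"
    and one: "P \<one>\<^bsub>G\<^esub> = id"
    and mult: "\<And>g h. g \<in> carrier G \<Longrightarrow> h \<in> carrier G \<Longrightarrow> P (g \<otimes>\<^bsub>G\<^esub> h) = P h \<circ> P g"
    and b: "\<And>g. g \<in> carrier G \<Longrightarrow> (\<lambda>i. (F (P g i) - F i)\<^sup>2) summable_on UNIV"
    and proper: "\<And>C. finite {g \<in> carrier G. (\<Sum>\<^sub>\<infinity>i. (F (P g i) - F i)\<^sup>2) \<le> C}"
  shows "has_proper_affine_isometric_action_on_hilbert_space G S"
proof -
  define A where "A g v = (\<lambda>i. v (P g i) + (F (P g i) - F i))" for g v
  have perm: "(\<lambda>i. (v (P g i))\<^sup>2) summable_on UNIV \<longleftrightarrow> (\<lambda>i. (v i)\<^sup>2) summable_on UNIV"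
    and norm: "(\<Sum>\<^sub>\<infinity>i. (v (P g i))\<^sup>2) = (\<Sum>\<^sub>\<infinity>i. (v i)\<^sup>2)"
    if "g \<in> carrier G" for g and v :: "nat \<Rightarrow> real"
    using summable_on_reindex_bij_betw[OF bij[OF that], of "\<lambda>i. (v i)\<^sup>2"]
      infsum_reindex_bij_betw[OF bij[OF that], of "\<lambda>i. (v i)\<^sup>2"] by simp_all
  have "linear_isometry l2 (\<lambda>v i. v (P g i))" if g: "g \<in> carrier G" for g
    unfolding linear_isometry_def
  proof (intro conjI)
    show "(\<lambda>v i. v (P g i)) ` carrier l2 = carrier l2"
    proof (intro equalityI subsetI)
      fix w assume w: "w \<in> carrier l2"
      have e: "(\<lambda>i. w (inv_into UNIV (P g) (P g i))) = w"
        by (simp add: bij[OF g] bij_is_inj)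
      thus "w \<in> (\<lambda>v i. v (P g i)) ` carrier l2"
        using w perm[OF g, of "\<lambda>i. w (inv_into UNIV (P g) i)"]
        by (intro image_eqI[of _ _ "\<lambda>i. w (inv_into UNIV (P g) i)"]) (auto simp: bij[OF g] bij_is_inj)
    qed (auto simp: perm[OF g])
  qed (auto simp: hnorm_l2 norm[OF g])
  \<comment> \<open>\<open>P\<close> reverses products, so precomposition with \<open>P g\<close> is
    a left action.\<close>
  hence "isometric_representation G l2 (\<lambda>g v i. v (P g i))"
    by (auto simp: isometric_representation_def one mult)
  hence aff: "affine_isometric_action G l2 A"
    unfolding affine_isometric_action_def
    by (intro exI[of _ "\<lambda>g v i. v (P g i)"] exI[of _ "\<lambda>g i. F (P g i) - F i"])
       (auto simp: b A_def mult fun_eq_iff)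
  have "metrically_proper G S l2 A"
    unfolding metrically_proper_def filterlim_at_top
  proof (intro ballI allI)
    fix v Z assume v: "v \<in> carrier l2"
    \<comment> \<open>The squared norm of the cocycle is at most twice that of \<open>A g v\<close>
      plus twice that of \<open>v\<close>. Hence a value above \<open>C\<close> forces
      \<open>Z \<le> hnorm l2 (A g v)\<close>.\<close>
    define C where "C = 2 * Z\<^sup>2 + 2 * (\<Sum>\<^sub>\<infinity>i. (v i)\<^sup>2)"
    define T where "T = {g \<in> carrier G. (\<Sum>\<^sub>\<infinity>i. (F (P g i) - F i)\<^sup>2) \<le> C}"
    have "finite T" unfolding T_def by (rule proper)
    \<comment> \<open>A finite set has bounded word length, so every \<open>g\<close> longer than
      \<open>N\<close> lies outside \<open>T\<close>.\<close>
    then obtain N where N: "\<And>g. g \<in> T \<Longrightarrow> word_length G S g \<le> N"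
      by (metis finite_imageI finite_nat_set_iff_bounded_le imageI)
    have Z: "Z \<le> hnorm l2 (A g v)" if g: "g \<in> carrier G" "g \<notin> T" for g
    proof -
      have s: "(\<lambda>i. (v (P g i))\<^sup>2) summable_on UNIV" using v perm[OF g(1)] by simp
      have sA: "(\<lambda>i. (A g v i)\<^sup>2) summable_on UNIV"
        unfolding A_def by (rule square_summable_add[OF s b[OF g(1)]])
      have "C < (\<Sum>\<^sub>\<infinity>i. (F (P g i) - F i)\<^sup>2)" using g by (auto simp: T_def)
      also have "\<dots> = (\<Sum>\<^sub>\<infinity>i. (A g v i + (-1) * v (P g i))\<^sup>2)" by (simp add: A_def)
      also have "\<dots> \<le> 2 * (\<Sum>\<^sub>\<infinity>i. (A g v i)\<^sup>2) + 2 * (\<Sum>\<^sub>\<infinity>i. ((-1) * v (P g i))\<^sup>2)"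
        by (rule square_summable_add(2)[OF sA square_summable_cmult[OF s]])
      also have "\<dots> = 2 * (\<Sum>\<^sub>\<infinity>i. (A g v i)\<^sup>2) + 2 * (\<Sum>\<^sub>\<infinity>i. (v i)\<^sup>2)" by (simp add: norm[OF g(1)])
      finally have "Z\<^sup>2 \<le> (\<Sum>\<^sub>\<infinity>i. (A g v i)\<^sup>2)" by (simp add: C_def)
      thus ?thesis by (simp add: hnorm_l2 real_le_rsqrt)
    qed
    have "\<forall>\<^sub>F g in inf (filtercomap (word_length G S) at_top) (principal (carrier G)). N < word_length G S g"
      by (rule filter_leD[OF inf_le1]) (rule eventually_filtercomapI[OF eventually_gt_at_top])
    moreover have "\<forall>\<^sub>F g in inf (filtercomap (word_length G S) at_top) (principal (carrier G)). g \<in> carrier G"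
      by (rule filter_leD[OF inf_le2]) (simp add: eventually_principal)
    ultimately show "\<forall>\<^sub>F g in inf (filtercomap (word_length G S) at_top) (principal (carrier G)). Z \<le> hnorm l2 (A g v)"
      by eventually_elim (use N Z in \<open>force\<close>)
  qed
  with real_hilbert_space_l2 aff show ?thesis
    unfolding has_proper_affine_isometric_action_on_hilbert_space_def by blast
qed

subsection \<open>Invariant probability measures\<close>

text \<open>By symmetry of \<open>S\<close> the inverses of generators are letters too, so finite
  words over \<open>S\<close> exhaust the group. Countability is used to merge null sets and to
  enumerate l^2 indices.\<close>

lemma countable_carrier_of_finitely_generated:
  fixes G (structure)
  assumes "group G" "symmetric_generating_set G S"
  shows "countable (carrier G)"
proof -
  interpret group G by fact
  have S: "S \<subseteq> carrier G" "m_inv G ` S = S" "generate G S = carrier G" "finite S"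
    using assms(2) by (auto simp: symmetric_generating_set_def)
  have "g \<in> (\<lambda>ws. foldr (\<otimes>) ws \<one>) ` lists S" if "g \<in> generate G S" for g
    using that
  proof (induction rule: generate.induct)
    case one
    show ?case by (rule image_eqI[of _ _ "[]"]) auto
  next
    case (incl h)
    thus ?case using S by (intro image_eqI[of _ _ "[h]"]) auto
  next
    case (inv h)
    thus ?case using S by (intro image_eqI[of _ _ "[inv h]"]) auto
  next
    case (eng g h)
    then obtain us ws where *: "us \<in> lists S" "ws \<in> lists S"
        "g = foldr (\<otimes>) us \<one>" "h = foldr (\<otimes>) ws \<one>" by blast
    have cl: "foldr (\<otimes>) vs \<one> \<in> carrier G" if "vs \<in> lists S" for vs
      using that S by (induction vs) auto
    have "foldr (\<otimes>) (us @ ws) \<one> = g \<otimes> h"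
      using * cl S unfolding *(3,4) by (induction us) (auto simp: m_assoc subset_iff)
    thus ?case using * by (intro image_eqI[of _ _ "us @ ws"]) auto
  qed
  hence "carrier G \<subseteq> (\<lambda>ws. foldr (\<otimes>) ws \<one>) ` lists S" using S by blast
  thus ?thesis
    using S(4) by (meson countable_finite countable_image countable_lists countable_subset)
qed

text \<open>The inequality that is not immediate follows by dividing by \<open>c\<close>. An
  infinite \<open>c\<close> would break the rule for positive \<open>f\<close> with infimum 0, and
  \<open>c = 0\<close> would break it over the empty index set.\<close>

lemma INF_cmult_ennreal:
  fixes c :: ennreal
  assumes "c < \<infinity>" "I \<noteq> {}"
  shows "c * (INF i\<in>I. f i) = (INF i\<in>I. c * f i)"
proof (cases "c = 0")
  case False
  show ?thesis
  proof (rule antisym)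
    show "c * (INF i\<in>I. f i) \<le> (INF i\<in>I. c * f i)"
      by (intro INF_greatest mult_left_mono INF_lower) auto
    have "(INF i\<in>I. c * f i) / c \<le> (INF i\<in>I. f i)"
    proof (rule INF_greatest)
      fix i assume "i \<in> I"
      hence "(INF i\<in>I. c * f i) \<le> c * f i" by (rule INF_lower)
      thus "(INF i\<in>I. c * f i) / c \<le> f i"
        using False by (simp add: divide_le_posI_ennreal mult.commute zero_less_iff_neq_zero)
    qed
    hence "c * ((INF i\<in>I. c * f i) / c) \<le> c * (INF i\<in>I. f i)"
      by (rule mult_left_mono) simp
    thus "(INF i\<in>I. c * f i) \<le> c * (INF i\<in>I. f i)"
      using False assms by (simp add: ennreal_times_divide mult_divide_eq_ennreal mult.commute[of c])
  qed
qed (use assms in simp)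

section \<open>The cocycle of Radon-Nikodym derivatives\<close>

locale quasi_invariant_action = group G + prob_space \<nu>
  for G :: "('g, 'm) monoid_scheme" (structure)
    and \<Phi> :: "'g \<Rightarrow> 'x::topological_space \<Rightarrow> 'x" and \<nu> :: "'x measure" +
  assumes homeo: "action_by_homeomorphisms G \<Phi>"
    and sets_nu [measurable_cong]: "sets \<nu> = sets borel"
    and class_preserved: "measure_class_preserved G \<Phi> \<nu>"
begin

lemma measurable_action [measurable]: "g \<in> carrier G \<Longrightarrow> \<Phi> g \<in> borel \<rightarrow>\<^sub>M borel"
  using homeo by (intro borel_measurable_continuous_onI)
    (auto simp: action_by_homeomorphisms_def dest!: homeomorphic_imp_continuous_map)

lemma action_mult: "g \<in> carrier G \<Longrightarrow> h \<in> carrier G \<Longrightarrow> \<Phi> (g \<otimes> h) x = \<Phi> g (\<Phi> h x)"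
  using homeo by (auto simp: action_by_homeomorphisms_def intro: group_action.composition_rule)

lemma action_inv: "g \<in> carrier G \<Longrightarrow> \<Phi> (inv g) (\<Phi> g x) = x"
  using homeo group_action.orbit_sym_aux by (fastforce simp: action_by_homeomorphisms_def)

lemma measurable_rho [measurable]: "rho \<Phi> \<nu> g \<in> borel_measurable borel"
  unfolding rho_def using borel_measurable_RN_deriv[of \<nu>] measurable_cong_sets[OF sets_nu refl] by blast

lemma density_rho: "g \<in> carrier G \<Longrightarrow> density \<nu> (rho \<Phi> \<nu> g) = distr \<nu> borel (\<Phi> g)"
  using class_preserved unfolding rho_def measure_class_preserved_def translate_measure_def
  by (intro density_RN_deriv) (auto simp: sets_nu)

lemma rho_finite: "g \<in> carrier G \<Longrightarrow> AE x in \<nu>. rho \<Phi> \<nu> g x \<noteq> \<infinity>"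
  using class_preserved unfolding rho_def measure_class_preserved_def translate_measure_def
  by (intro RN_deriv_finite prob_space_imp_sigma_finite prob_space_distr) (auto simp: sets_nu)

text \<open>Change of variables: \<open>w\<close> is first written as a function of
  \<open>\<Phi> g x\<close>, so that it can be moved past the push-forward, and the push-forward of
  \<open>\<nu>\<close> has density \<open>rho \<Phi> \<nu> g\<close>. With \<open>w\<close> a
  derivative this yields the cocycle identity, with \<open>w\<close> an equivariant weight an
  invariant measure.\<close>

lemma distr_density_action:
  assumes g: "g \<in> carrier G" and [measurable]: "w \<in> borel_measurable borel"
  shows "distr (density \<nu> w) borel (\<Phi> g) = density \<nu> (\<lambda>x. rho \<Phi> \<nu> g x * w (\<Phi> (inv g) x))"
proof -
  note [measurable] = measurable_action[OF g] measurable_action[OF inv_closed[OF g]]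
  have "density \<nu> (\<lambda>x. rho \<Phi> \<nu> g x * w (\<Phi> (inv g) x)) =
      density (density \<nu> (rho \<Phi> \<nu> g)) (\<lambda>x. w (\<Phi> (inv g) x))"
    by (subst density_density_eq) auto
  also have "\<dots> = distr (density \<nu> (\<lambda>x. w (\<Phi> (inv g) (\<Phi> g x)))) borel (\<Phi> g)"
    unfolding density_rho[OF g] by (rule density_distr) auto
  finally show ?thesis by (simp add: action_inv[OF g])
qed

text \<open>Both sides are densities of the measure obtained by pushing \<open>\<nu>\<close> forward
  along \<open>h\<close> and then \<open>g\<close>, and such densities are unique up to a null set,
  which depends on \<open>g\<close> and \<open>h\<close>.\<close>

lemma rho_mult:
  assumes g: "g \<in> carrier G" and h: "h \<in> carrier G"
  shows "AE x in \<nu>. rho \<Phi> \<nu> (g \<otimes> h) x = rho \<Phi> \<nu> g x * rho \<Phi> \<nu> h (\<Phi> (inv g) x)"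
proof -
  note [measurable] = measurable_action[OF g] measurable_action[OF h] measurable_action[OF inv_closed[OF g]]
  have "density \<nu> (\<lambda>x. rho \<Phi> \<nu> g x * rho \<Phi> \<nu> h (\<Phi> (inv g) x)) = distr (distr \<nu> borel (\<Phi> h)) borel (\<Phi> g)"
    using distr_density_action[OF g measurable_rho[of h]] by (simp add: density_rho[OF h])
  also have "\<dots> = translate_measure \<Phi> \<nu> (g \<otimes> h)"
    unfolding translate_measure_def by (subst distr_distr) (auto simp: action_mult g h fun_eq_iff intro!: distr_cong)
  finally have "AE x in \<nu>. rho \<Phi> \<nu> g x * rho \<Phi> \<nu> h (\<Phi> (inv g) x) = rho \<Phi> \<nu> (g \<otimes> h) x"
    unfolding rho_def[of _ _ "g \<otimes> h"] by (intro RN_deriv_unique) auto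
  thus ?thesis by eventually_elim simp
qed

lemma rho_one: "AE x in \<nu>. rho \<Phi> \<nu> \<one> x = 1"
proof -
  \<comment> \<open>\<open>\<Phi> \<one>\<close> is idempotent and its own inverse.\<close>
  have "\<Phi> \<one> x = x" for x
    using action_inv[of \<one> "\<Phi> \<one> x"] action_mult[of \<one> \<one> x] by simp
       (metis action_inv inv_one one_closed)
  hence "\<Phi> \<one> = id" by auto
  hence "density \<nu> (\<lambda>_. 1) = translate_measure \<Phi> \<nu> \<one>"
    by (auto simp: translate_measure_def density_1 sets_nu id_def intro!: distr_id2[symmetric])
  from RN_deriv_unique[OF _ this] show ?thesis
    unfolding rho_def by (auto elim: AE_mp)
qed

lemma left_translate_carrier: "g \<in> carrier G \<Longrightarrow> (\<lambda>h. g \<otimes> h) ` carrier G = carrier G"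
  by (simp add: surj_const_mult)

text \<open>Left translation by \<open>g\<close> permutes the index set of the supremum, and the
  cocycle identity pulls out a common factor. Countability puts the exceptional sets of all
  \<open>h\<close> into one null set.\<close>

lemma rho_sup_translate:
  assumes "countable (carrier G)" and g: "g \<in> carrier G"
  shows "AE x in \<nu>. rho_sup G \<Phi> \<nu> x = rho \<Phi> \<nu> g x * rho_sup G \<Phi> \<nu> (\<Phi> (inv g) x)"
proof -
  have "AE x in \<nu>. \<forall>h\<in>carrier G. rho \<Phi> \<nu> (g \<otimes> h) x = rho \<Phi> \<nu> g x * rho \<Phi> \<nu> h (\<Phi> (inv g) x)"
    using assms rho_mult by (simp add: AE_ball_countable)
  thus ?thesis
  proof eventually_elim
    case (elim x)
    have "rho_sup G \<Phi> \<nu> x = (SUP h\<in>carrier G. rho \<Phi> \<nu> (g \<otimes> h) x)"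
      unfolding rho_sup_def by (subst left_translate_carrier[OF g, symmetric]) (simp add: image_image)
    also have "\<dots> = (SUP h\<in>carrier G. rho \<Phi> \<nu> g x * rho \<Phi> \<nu> h (\<Phi> (inv g) x))"
      using elim by (intro SUP_cong) auto
    finally show ?case by (simp add: rho_sup_def SUP_mult_left_ennreal)
  qed
qed

text \<open>As for the supremum, except that an infinite factor need not pass through an infimum;
  the factor is finite almost everywhere.\<close>

lemma rho_inf_translate:
  assumes "countable (carrier G)" and g: "g \<in> carrier G"
  shows "AE x in \<nu>. rho_inf G \<Phi> \<nu> x = rho \<Phi> \<nu> g x * rho_inf G \<Phi> \<nu> (\<Phi> (inv g) x)"
proof -
  have "AE x in \<nu>. \<forall>h\<in>carrier G. rho \<Phi> \<nu> (g \<otimes> h) x = rho \<Phi> \<nu> g x * rho \<Phi> \<nu> h (\<Phi> (inv g) x)"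
    using assms rho_mult by (simp add: AE_ball_countable)
  thus ?thesis using rho_finite[OF g]
  proof eventually_elim
    case (elim x)
    have "rho_inf G \<Phi> \<nu> x = (INF h\<in>carrier G. rho \<Phi> \<nu> (g \<otimes> h) x)"
      unfolding rho_inf_def by (subst left_translate_carrier[OF g, symmetric]) (simp add: image_image)
    also have "\<dots> = (INF h\<in>carrier G. rho \<Phi> \<nu> g x * rho \<Phi> \<nu> h (\<Phi> (inv g) x))"
      using elim by (intro INF_cong) auto
    also have "\<dots> = rho \<Phi> \<nu> g x * rho_inf G \<Phi> \<nu> (\<Phi> (inv g) x)"
      unfolding rho_inf_def using elim one_closed
      by (intro INF_cmult_ennreal[symmetric]) (auto simp: top.not_eq_extremum)
    finally show ?case .
  qed
qed

text \<open>Pushing the measure with density \<open>w\<close> forward by \<open>g\<close> reproduces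
  the density \<open>w\<close> by equivariance. A positive finite integral allows
  normalisation.\<close>

lemma invariant_prob_measure_density:
  assumes [measurable]: "w \<in> borel_measurable borel"
    and w: "\<And>g. g \<in> carrier G \<Longrightarrow> AE x in \<nu>. w x = rho \<Phi> \<nu> g x * w (\<Phi> (inv g) x)"
    and pos: "(\<integral>\<^sup>+x. w x \<partial>\<nu>) > 0" and fin: "(\<integral>\<^sup>+x. w x \<partial>\<nu>) < \<infinity>"
  obtains \<mu> where "prob_space \<mu>" "sets \<mu> = sets borel" "\<And>g. g \<in> carrier G \<Longrightarrow> distr \<mu> borel (\<Phi> g) = \<mu>"
proof
  define c where "c = (\<integral>\<^sup>+x. w x \<partial>\<nu>)"
  define \<mu> where "\<mu> = density \<nu> (\<lambda>x. w x / c)"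
  have [measurable]: "(\<lambda>x. w x / c) \<in> borel_measurable borel" by measurable
  have "emeasure \<mu> (space \<mu>) = (\<integral>\<^sup>+x. w x / c \<partial>\<nu>)"
    unfolding \<mu>_def by (subst emeasure_density) (auto intro!: nn_integral_cong)
  also have "\<dots> = c / c"
    unfolding c_def by (rule nn_integral_divide) measurable
  also have "\<dots> = 1" using pos fin by (auto simp: c_def ennreal_divide_self)
  finally show "prob_space \<mu>" by (rule prob_spaceI)
  show "sets \<mu> = sets borel" by (simp add: \<mu>_def sets_nu)
  fix g assume g: "g \<in> carrier G"
  note [measurable] = measurable_action[OF inv_closed[OF g]]
  show "distr \<mu> borel (\<Phi> g) = \<mu>"
    unfolding \<mu>_def distr_density_action[OF g \<open>(\<lambda>x. w x / c) \<in> borel_measurable borel\<close>]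
    by (rule density_cong) (use w[OF g] in \<open>auto simp: ennreal_times_divide\<close>)
qed

text \<open>Since the derivative at \<open>\<one>\<close> is 1 almost everywhere, the supremum is at
  least 1 and the infimum at most 1. Each alternative hypothesis thus supplies the one bound on the
  integral that is not automatic.\<close>

lemma invariant_prob_measure:
  assumes "countable (carrier G)"
    and "(\<integral>\<^sup>+x. rho_sup G \<Phi> \<nu> x \<partial>\<nu>) < \<infinity> \<or> (\<integral>\<^sup>+x. rho_inf G \<Phi> \<nu> x \<partial>\<nu>) > 0"
  obtains \<mu> where "prob_space \<mu>" "sets \<mu> = sets borel" "\<And>g. g \<in> carrier G \<Longrightarrow> distr \<mu> borel (\<Phi> g) = \<mu>"
proof -
  have msup: "rho_sup G \<Phi> \<nu> \<in> borel_measurable borel" and minf: "rho_inf G \<Phi> \<nu> \<in> borel_measurable borel"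
    unfolding rho_sup_def[abs_def] rho_inf_def[abs_def]
    using assms(1) by (auto intro!: borel_measurable_SUP borel_measurable_INF)
  from assms(2) show thesis
  proof
    assume fin: "(\<integral>\<^sup>+x. rho_sup G \<Phi> \<nu> x \<partial>\<nu>) < \<infinity>"
    have "AE x in \<nu>. 1 \<le> rho_sup G \<Phi> \<nu> x"
      using rho_one by eventually_elim (auto simp: rho_sup_def intro: SUP_upper2[of \<one>])
    hence "(\<integral>\<^sup>+x. 1 \<partial>\<nu>) \<le> (\<integral>\<^sup>+x. rho_sup G \<Phi> \<nu> x \<partial>\<nu>)"
      by (rule nn_integral_mono_AE)
    hence "(\<integral>\<^sup>+x. rho_sup G \<Phi> \<nu> x \<partial>\<nu>) > 0"
      using emeasure_space_1 by (auto simp: zero_less_iff_neq_zero)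
    from invariant_prob_measure_density[OF msup rho_sup_translate[OF assms(1)] this fin] that
    show thesis by blast
  next
    assume pos: "(\<integral>\<^sup>+x. rho_inf G \<Phi> \<nu> x \<partial>\<nu>) > 0"
    have "AE x in \<nu>. rho_inf G \<Phi> \<nu> x \<le> 1"
      using rho_one by eventually_elim (auto simp: rho_inf_def intro: INF_lower2[of \<one>])
    hence "(\<integral>\<^sup>+x. rho_inf G \<Phi> \<nu> x \<partial>\<nu>) \<le> (\<integral>\<^sup>+x. 1 \<partial>\<nu>)"
      by (rule nn_integral_mono_AE)
    hence "(\<integral>\<^sup>+x. rho_inf G \<Phi> \<nu> x \<partial>\<nu>) < \<infinity>"
      using emeasure_space_1 by (auto simp: le_less_trans)
    from invariant_prob_measure_density[OF minf rho_inf_translate[OF assms(1)] pos this] that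
    show thesis by blast
  qed
qed

end

subsection \<open>Almost invariant vectors\<close>

text \<open>The reverse triangle inequality in L^2. It rests on the Cauchy-Schwarz inequality,
  obtained from nonnegativity of the quadratic polynomial
  \<open>t \<mapsto> A + 2 * t * P + t\<^sup>2 * B\<close>.\<close>

lemma L2_norm_diff_le:
  fixes a b :: "'x \<Rightarrow> real"
  assumes a: "integrable M (\<lambda>x. (a x)\<^sup>2)" and b: "integrable M (\<lambda>x. (b x)\<^sup>2)"
    and ab: "integrable M (\<lambda>x. a x * b x)"
  shows "(sqrt (\<integral>x. (a x)\<^sup>2 \<partial>M) - sqrt (\<integral>x. (b x)\<^sup>2 \<partial>M))\<^sup>2 \<le> (\<integral>x. (a x - b x)\<^sup>2 \<partial>M)"
proof -
  define A B P where "A = (\<integral>x. (a x)\<^sup>2 \<partial>M)" and "B = (\<integral>x. (b x)\<^sup>2 \<partial>M)" and "P = (\<integral>x. a x * b x \<partial>M)"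
  have expand: "(\<integral>x. (a x + t * b x)\<^sup>2 \<partial>M) = A + 2 * t * P + t\<^sup>2 * B" for t
  proof -
    have "(\<lambda>x. (a x + t * b x)\<^sup>2) = (\<lambda>x. (a x)\<^sup>2 + (2 * t) * (a x * b x) + t\<^sup>2 * (b x)\<^sup>2)"
      by (auto simp: power2_eq_square algebra_simps)
    thus ?thesis using a b ab by (simp add: A_def B_def P_def)
  qed
  have nonneg: "0 \<le> A + 2 * t * P + t\<^sup>2 * B" for t
    unfolding expand[symmetric] by simp
  have "0 \<le> A" "0 \<le> B" by (simp_all add: A_def B_def)
  have "P\<^sup>2 \<le> A * B"
  proof (cases "B = 0")
    case True
    have "P = 0"
    proof (rule ccontr)
      assume "P \<noteq> 0"
      \<comment> \<open>For \<open>B = 0\<close> the polynomial is affine in \<open>t\<close>, and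
        at this point its value is -1.\<close>
      thus False using nonneg[of "- (A + 1) / (2 * P)"] True by simp
    qed
    thus ?thesis using True by simp
  next
    case False
    hence "0 < B" using \<open>0 \<le> B\<close> by simp
    \<comment> \<open>This is the minimum of the polynomial, attained at
      \<open>t = - P / B\<close>.\<close>
    have "0 \<le> A - P\<^sup>2 / B"
      using nonneg[of "- P / B"] False by (simp add: power2_eq_square field_simps)
    thus ?thesis using \<open>0 < B\<close> by (simp add: field_simps)
  qed
  hence "P \<le> sqrt A * sqrt B"
    unfolding real_sqrt_mult[symmetric] by (rule real_le_rsqrt)
  hence "(sqrt A - sqrt B)\<^sup>2 \<le> A + 2 * (-1) * P + (-1)\<^sup>2 * B"
    using \<open>0 \<le> A\<close> \<open>0 \<le> B\<close> by (simp add: power2_diff)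
  also have "\<dots> = (\<integral>x. (a x - b x)\<^sup>2 \<partial>M)" using expand[of "-1"] by simp
  finally show ?thesis by (simp add: A_def B_def)
qed

text \<open>A finitely supported unit vector of l^2(G) whose translates by generators lie within
  squared distance \<open>e\<close>. Testing on finite \<open>K\<close> expresses this without
  infinite sums.\<close>

definition almost_invariant_vector ::
    "('g, 'm) monoid_scheme \<Rightarrow> 'g set \<Rightarrow> real \<Rightarrow> ('g \<Rightarrow> real) \<Rightarrow> bool" where
  "almost_invariant_vector G S e f \<longleftrightarrow>
     finite {h \<in> carrier G. f h \<noteq> 0} \<and> (\<Sum>h | h \<in> carrier G \<and> f h \<noteq> 0. (f h)\<^sup>2) = 1 \<and>
     (\<forall>s\<in>S. \<forall>K. finite K \<and> K \<subseteq> carrier G \<longrightarrow>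
        (\<Sum>h\<in>K. (f (inv\<^bsub>G\<^esub> s \<otimes>\<^bsub>G\<^esub> h) - f h)\<^sup>2) \<le> e)"

text \<open>Take \<open>f h\<close> to be the L^2(\<mu>) norm of \<open>\<xi> h\<close>. Invariance
  of \<open>\<mu>\<close> identifies translates of \<open>f\<close> with norms of translates of
  \<open>\<xi>\<close>; the reverse triangle inequality in each coordinate then reduces the defect
  of \<open>f\<close> to the integral of the pointwise defect of \<open>\<xi>\<close>.\<close>

lemma almost_invariant_vector_exists:
  fixes G :: "('g, 'm) monoid_scheme" (structure)
    and \<Phi> :: "'g \<Rightarrow> 'x::topological_space \<Rightarrow> 'x"
  assumes "group G" and S: "finite S" "S \<subseteq> carrier G"
    and cpt: "compact (UNIV :: 'x set)"
    and act: "action_by_homeomorphisms G \<Phi>"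
    and "prob_space \<mu>" and sets: "sets \<mu> = sets borel"
    and invariant: "\<And>g. g \<in> carrier G \<Longrightarrow> distr \<mu> borel (\<Phi> g) = \<mu>"
    and amen: "topologically_amenable G S \<Phi>" and "e > 0"
  shows "\<exists>f. almost_invariant_vector G S e f"
proof -
  interpret group G by fact
  interpret prob_space \<mu> by fact
  \<comment> \<open>The factor 2 comes from expanding the squared difference of unit vectors,
    \<open>card S\<close> from passing from the average over \<open>S\<close> to one generator;
    adding 1 keeps the denominator positive when \<open>S\<close> is empty.\<close>
  define \<epsilon> where "\<epsilon> = e / (2 * (real (card S) + 1))"
  have "\<epsilon> > 0" using \<open>e > 0\<close> by (simp add: \<epsilon>_def add_nonneg_pos)
  have eps: "2 * (real (card S) * \<epsilon>) \<le> e"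
    using \<open>e > 0\<close> by (simp add: \<epsilon>_def field_simps)
  from amen[unfolded topologically_amenable_def, rule_format, OF \<open>\<epsilon> > 0\<close>]
  obtain \<xi> where \<xi>: "\<xi> \<in> fin_supp_maps G" and pos: "\<And>g x. g \<in> carrier G \<Longrightarrow> 0 \<le> \<xi> g x"
    and one: "\<And>x. CX_inner G \<xi> \<xi> x = 1"
    and sup: "(SUP x. 1 - 1 / real (card S) * (\<Sum>s\<in>S. CX_inner G \<xi> (left_translate G \<Phi> s \<xi>) x)) \<le> \<epsilon>"
    by blast
  define T where "T = {h \<in> carrier G. \<xi> h \<noteq> (\<lambda>_. 0)}"
  have T: "finite T" "T \<subseteq> carrier G" and cont: "\<And>h. h \<in> carrier G \<Longrightarrow> continuous_on UNIV (\<xi> h)"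
    using \<xi> by (auto simp: T_def fin_supp_maps_def)
  have inner_eq: "CX_inner G \<xi> \<eta> x = (\<Sum>h\<in>K. \<xi> h x * \<eta> h x)"
    if "finite K" "T \<subseteq> K" "K \<subseteq> carrier G" for K \<eta> x
  proof -
    have "CX_inner G \<xi> \<eta> x = sum' (\<lambda>h. \<xi> h x * \<eta> h x) K"
      unfolding CX_inner_def using that by (intro sum.mono_neutral_right') (auto simp: T_def)
    thus ?thesis using that by simp
  qed
  define L where "L = (\<lambda>s h x. \<xi> (inv s \<otimes> h) (\<Phi> (inv s) x))"
  have L: "left_translate G \<Phi> s \<xi> = L s" for s by (simp add: left_translate_def L_def)
  have cont_act: "continuous_on UNIV (\<Phi> g)" if "g \<in> carrier G" for g
    using act that by (auto simp: action_by_homeomorphisms_def dest!: homeomorphic_imp_continuous_map)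
  have cont_L: "continuous_on UNIV (L s h)" if "s \<in> carrier G" "h \<in> carrier G" for s h
    unfolding L_def using that
    by (intro continuous_on_compose2[OF cont cont_act]) auto
  have integrable: "integrable \<mu> u" if u: "continuous_on UNIV u" for u :: "'x \<Rightarrow> real"
  proof -
    have "bounded (range u)"
      using compact_continuous_image[OF u cpt] by (rule compact_imp_bounded)
    then obtain B where "\<And>x. norm (u x) \<le> B" by (auto simp: bounded_iff)
    thus ?thesis
      using borel_measurable_continuous_onI[OF u] measurable_cong_sets[OF sets refl]
      by (intro integrable_const_bound[of _ B]) auto
  qed
  note cont_intros = continuous_on_power continuous_on_mult continuous_on_diff continuous_on_sum
  \<comment> \<open>A finite set containing \<open>K\<close> and the supports of
    \<open>\<xi>\<close> and of its translate by \<open>s\<close>, so that full norms and inner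
    products are finite sums over it.\<close>
  define supp where "supp s K = K \<union> T \<union> (\<otimes>) s ` T" for s K
  have supp: "finite (supp s K)" "T \<subseteq> supp s K" "supp s K \<subseteq> carrier G" "K \<subseteq> supp s K"
    if "s \<in> carrier G" "finite K" "K \<subseteq> carrier G" for s K
    using that T by (auto simp: supp_def)
  have norm_L: "(\<Sum>h\<in>supp s K. (L s h x)\<^sup>2) = 1"
    if s: "s \<in> carrier G" "finite K" "K \<subseteq> carrier G" for s K x
  proof -
    have "(\<Sum>h\<in>supp s K. (L s h x)\<^sup>2) = (\<Sum>h\<in>(\<otimes>) s ` T. (L s h x)\<^sup>2)"
    proof (rule sum.mono_neutral_right)
      show "\<forall>h\<in>supp s K - (\<otimes>) s ` T. (L s h x)\<^sup>2 = 0"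
      proof
        fix h assume h: "h \<in> supp s K - (\<otimes>) s ` T"
        hence hc: "h \<in> carrier G" using supp(3)[OF s] by blast
        have "h = s \<otimes> (inv s \<otimes> h)" using hc s by (simp add: m_assoc[symmetric])
        hence "inv s \<otimes> h \<notin> T" using h by blast
        thus "(L s h x)\<^sup>2 = 0" using hc s by (simp add: L_def T_def)
      qed
    qed (use supp[OF s] in \<open>auto simp: supp_def\<close>)
    also have "\<dots> = (\<Sum>h\<in>T. (L s (s \<otimes> h) x)\<^sup>2)"
      by (subst sum.reindex) (use s T in \<open>auto intro: inj_onI simp: subset_iff\<close>)
    also have "\<dots> = (\<Sum>h\<in>T. (\<xi> h (\<Phi> (inv s) x))\<^sup>2)"
      using s T by (intro sum.cong) (auto simp: L_def m_assoc[symmetric] subset_iff)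
    also have "\<dots> = 1"
      using one[of "\<Phi> (inv s) x"] inner_eq[OF T(1) _ T(2), of \<xi>] by (simp add: power2_eq_square)
    finally show ?thesis .
  qed
  have diff: "(\<Sum>h\<in>supp s K. (L s h x - \<xi> h x)\<^sup>2) = 2 * (1 - CX_inner G \<xi> (L s) x)"
    if s: "s \<in> carrier G" "finite K" "K \<subseteq> carrier G" for s K x
  proof -
    have "(\<Sum>h\<in>supp s K. (L s h x - \<xi> h x)\<^sup>2) =
        (\<Sum>h\<in>supp s K. (L s h x)\<^sup>2) + (\<Sum>h\<in>supp s K. \<xi> h x * \<xi> h x) - 2 * (\<Sum>h\<in>supp s K. \<xi> h x * L s h x)"
      by (simp add: power2_eq_square algebra_simps sum.distrib sum_subtractf sum_distrib_left)
    thus ?thesis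
      using norm_L[OF s] one[of x] by (simp add: inner_eq[OF supp(1-3)[OF s]])
  qed
  have defect: "1 - CX_inner G \<xi> (L s) x \<le> real (card S) * \<epsilon>" if s: "s \<in> S" for s x
  proof -
    have card: "real (card S) > 0" using s S by (auto simp: card_gt_0_iff)
    \<comment> \<open>A real supremum dominates its members only for a range bounded above;
      nonnegativity of \<open>\<xi>\<close> gives the bound 1.\<close>
    have "0 \<le> CX_inner G \<xi> (L s) y" if "s \<in> S" for s y
      unfolding inner_eq[OF T(1) order.refl T(2)]
      using that S T pos by (intro sum_nonneg mult_nonneg_nonneg) (auto simp: L_def subset_iff)
    hence "bdd_above (range (\<lambda>x. 1 - 1 / real (card S) * (\<Sum>s\<in>S. CX_inner G \<xi> (L s) x)))"
      by (intro bdd_aboveI2[of _ _ 1]) (simp add: sum_nonneg)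
    hence "1 - 1 / real (card S) * (\<Sum>s\<in>S. CX_inner G \<xi> (L s) x) \<le> \<epsilon>"
      by (rule order.trans[OF cSUP_upper[OF UNIV_I] sup[unfolded L]])
    hence "real (card S) - (\<Sum>s\<in>S. CX_inner G \<xi> (L s) x) \<le> real (card S) * \<epsilon>"
      using card by (simp add: field_simps)
    hence "(\<Sum>s\<in>S. 1 - CX_inner G \<xi> (L s) x) \<le> real (card S) * \<epsilon>"
      by (simp add: sum_subtractf)
    \<comment> \<open>Each defect is half a sum of squares, hence nonnegative, so a single one is
      bounded by the sum over \<open>S\<close>.\<close>
    moreover have "0 \<le> 1 - CX_inner G \<xi> (L s) x" if "s \<in> S" for s
    proof -
      have "0 \<le> (\<Sum>h\<in>supp s {}. (L s h x - \<xi> h x)\<^sup>2)" by (rule sum_nonneg) simp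
      thus ?thesis using diff[of s "{}" x] that S by auto
    qed
    hence "1 - CX_inner G \<xi> (L s) x \<le> (\<Sum>s\<in>S. 1 - CX_inner G \<xi> (L s) x)"
      using s S by (intro member_le_sum) auto
    ultimately show ?thesis by linarith
  qed
  define f where "f h = sqrt (\<integral>x. (\<xi> h x)\<^sup>2 \<partial>\<mu>)" for h
  have f_translate: "f (inv s \<otimes> h) = sqrt (\<integral>x. (L s h x)\<^sup>2 \<partial>\<mu>)"
    if "s \<in> carrier G" "h \<in> carrier G" for s h
  proof -
    have [measurable]: "\<xi> (inv s \<otimes> h) \<in> borel_measurable borel" "\<Phi> (inv s) \<in> \<mu> \<rightarrow>\<^sub>M borel"
      using that by (auto simp: measurable_cong_sets[OF sets refl] intro!: borel_measurable_continuous_onI cont cont_act)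
    have "(\<integral>x. (\<xi> (inv s \<otimes> h) x)\<^sup>2 \<partial>\<mu>) = (\<integral>x. (\<xi> (inv s \<otimes> h) x)\<^sup>2 \<partial>distr \<mu> borel (\<Phi> (inv s)))"
      using invariant[of "inv s"] that by simp
    also have "\<dots> = (\<integral>x. (L s h x)\<^sup>2 \<partial>\<mu>)"
      unfolding L_def by (rule integral_distr) auto
    finally show ?thesis by (simp add: f_def)
  qed
  have supp_f: "{h \<in> carrier G. f h \<noteq> 0} \<subseteq> T"
    by (auto simp: f_def T_def)
  have "almost_invariant_vector G S e f"
    unfolding almost_invariant_vector_def
  proof (intro conjI ballI allI impI)
    show "finite {h \<in> carrier G. f h \<noteq> 0}" using supp_f T(1) by (rule finite_subset)
    have "(\<Sum>h | h \<in> carrier G \<and> f h \<noteq> 0. (f h)\<^sup>2) = (\<Sum>h\<in>T. (f h)\<^sup>2)"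
      using supp_f T by (intro sum.mono_neutral_left) auto
    also have "\<dots> = (\<Sum>h\<in>T. \<integral>x. (\<xi> h x)\<^sup>2 \<partial>\<mu>)" by (simp add: f_def)
    also have "\<dots> = (\<integral>x. (\<Sum>h\<in>T. (\<xi> h x)\<^sup>2) \<partial>\<mu>)"
      using T by (intro Bochner_Integration.integral_sum[symmetric] integrable cont_intros cont) auto
    also have "\<dots> = 1"
      using one inner_eq[OF T(1) order.refl T(2), of \<xi>] by (simp add: power2_eq_square prob_space)
    finally show "(\<Sum>h | h \<in> carrier G \<and> f h \<noteq> 0. (f h)\<^sup>2) = 1" .
    fix s K assume s: "s \<in> S" and "finite K \<and> K \<subseteq> carrier G"
    hence K: "finite K" "K \<subseteq> carrier G" and sc: "s \<in> carrier G" using S by auto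
    note sp = supp[OF sc K]
    have "(\<Sum>h\<in>K. (f (inv s \<otimes> h) - f h)\<^sup>2) \<le> (\<Sum>h\<in>supp s K. (f (inv s \<otimes> h) - f h)\<^sup>2)"
      using sp by (intro sum_mono2) auto
    also have "\<dots> \<le> (\<Sum>h\<in>supp s K. \<integral>x. (L s h x - \<xi> h x)\<^sup>2 \<partial>\<mu>)"
    proof (rule sum_mono)
      fix h assume "h \<in> supp s K"
      hence "h \<in> carrier G" using sp by blast
      thus "(f (inv s \<otimes> h) - f h)\<^sup>2 \<le> (\<integral>x. (L s h x - \<xi> h x)\<^sup>2 \<partial>\<mu>)"
        unfolding f_translate[OF sc \<open>h \<in> carrier G\<close>] unfolding f_def
        by (intro L2_norm_diff_le integrable cont_intros cont cont_L sc)
    qed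
    also have "\<dots> = (\<integral>x. (\<Sum>h\<in>supp s K. (L s h x - \<xi> h x)\<^sup>2) \<partial>\<mu>)"
      using sp sc by (intro Bochner_Integration.integral_sum[symmetric] integrable cont_intros cont cont_L) auto
    also have "\<dots> \<le> (\<integral>x. 2 * (real (card S) * \<epsilon>) \<partial>\<mu>)"
    proof (rule integral_mono)
      show "integrable \<mu> (\<lambda>x. \<Sum>h\<in>supp s K. (L s h x - \<xi> h x)\<^sup>2)"
        using sp sc by (intro integrable cont_intros cont cont_L) auto
      show "(\<Sum>h\<in>supp s K. (L s h x - \<xi> h x)\<^sup>2) \<le> 2 * (real (card S) * \<epsilon>)" for x
        unfolding diff[OF sc K] using defect[OF s, of x] by (intro mult_left_mono) auto
    qed simp
    also have "\<dots> \<le> e" using eps by (simp add: prob_space)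
    finally show "(\<Sum>h\<in>K. (f (inv s \<otimes> h) - f h)\<^sup>2) \<le> e" .
  qed
  thus ?thesis by blast
qed

section \<open>A proper cocycle from almost invariant vectors\<close>

lemma proper_action_from_almost_invariant_vectors:
  fixes G :: "('g, 'm) monoid_scheme" (structure) and f :: "nat \<Rightarrow> 'g \<Rightarrow> real"
  assumes "group G" and S: "symmetric_generating_set G S" and count: "countable (carrier G)"
    and f: "\<And>n. almost_invariant_vector G S ((1/2) ^ n) (f n)"
  shows "has_proper_affine_isometric_action_on_hilbert_space G S"
proof -
  interpret group G by fact
  have fin: "finite {h \<in> carrier G. f n h \<noteq> 0}"
    and unit: "(\<Sum>h | h \<in> carrier G \<and> f n h \<noteq> 0. (f n h)\<^sup>2) = 1" for n
    using f[of n] by (simp_all add: almost_invariant_vector_def)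
  have small: "(\<Sum>h\<in>K. (f n (inv s \<otimes> h) - f n h)\<^sup>2) \<le> (1/2) ^ n"
    if "s \<in> S" "finite K" "K \<subseteq> carrier G" for n s K
    using f[of n] that by (auto simp: almost_invariant_vector_def)
  define I where "I = (UNIV :: nat set) \<times> carrier G"
  \<comment> \<open>The factor \<open>nat\<close> makes \<open>I\<close> infinite even for finite
    \<open>G\<close>, so that it can be enumerated bijectively.\<close>
  have I: "countable I" "infinite I"
    using count one_closed by (auto simp: I_def finite_cartesian_product_iff)
  define \<iota> where "\<iota> = from_nat_into I"
  have \<iota>: "bij_betw \<iota> UNIV I" unfolding \<iota>_def using I by (rule bij_betw_from_nat_into)
  have \<iota>_in: "snd (\<iota> i) \<in> carrier G" for i
  proof -
    have "\<iota> i \<in> I" using bij_betwE[OF \<iota>] by blast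
    thus ?thesis unfolding I_def by (rule mem_Times_iff[THEN iffD1, THEN conjunct2])
  qed
  define P where "P g i = to_nat_on I (fst (\<iota> i), inv g \<otimes> snd (\<iota> i))" for g i
  have \<iota>_P: "\<iota> (P g i) = (fst (\<iota> i), inv g \<otimes> snd (\<iota> i))" if "g \<in> carrier G" for g i
    unfolding P_def \<iota>_def using that \<iota>_in[of i] I by (subst from_nat_into_to_nat_on) (auto simp: I_def \<iota>_def)
  have \<iota>_inj: "\<iota> i = \<iota> j \<Longrightarrow> i = j" for i j
    using \<iota> by (auto simp: bij_betw_def inj_def)
  have P_one: "P \<one> = id"
    by (rule ext, rule \<iota>_inj) (simp add: \<iota>_P \<iota>_in)
  have P_mult: "P (g \<otimes> h) = P h \<circ> P g" if "g \<in> carrier G" "h \<in> carrier G" for g h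
    by (rule ext, rule \<iota>_inj) (use that in \<open>simp add: \<iota>_P \<iota>_in inv_mult_group m_assoc\<close>)
  have P_bij: "bij (P g)" if "g \<in> carrier G" for g
    using P_mult[of g "inv g"] P_mult[of "inv g" g] that P_one
    by (intro o_bij[of "P (inv g)"]) auto
  define F where "F i = f (fst (\<iota> i)) (snd (\<iota> i))" for i
  define d where "d g = (\<lambda>(n, h). (f n (inv g \<otimes> h) - f n h)\<^sup>2)" for g
  have d: "(F (P g i) - F i)\<^sup>2 = d g (\<iota> i)" if "g \<in> carrier G" for g i
    using that by (simp add: F_def d_def \<iota>_P case_prod_unfold)
  \<comment> \<open>Layer \<open>n\<close> contributes at most \<open>(1/2) ^ n\<close>, so all
    finite partial sums are at most 2.\<close>
  have summable_S: "d s summable_on I" if s: "s \<in> S" for s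
  proof (rule nonneg_bdd_above_summable_on)
    show "bdd_above (sum (d s) ` {K. K \<subseteq> I \<and> finite K})"
    proof (rule bdd_aboveI2)
      fix K assume "K \<in> {K. K \<subseteq> I \<and> finite K}"
      hence K: "K \<subseteq> I" "finite K" by auto
      then obtain N where N: "\<And>k. k \<in> K \<Longrightarrow> fst k < N"
        by (metis finite_imageI finite_nat_set_iff_bounded imageI)
      have "sum (d s) K \<le> sum (d s) ({..<N} \<times> snd ` K)"
        using K N by (intro sum_mono2) (force simp: d_def)+
      also have "\<dots> = (\<Sum>n<N. \<Sum>h\<in>snd ` K. (f n (inv s \<otimes> h) - f n h)\<^sup>2)"
        by (simp add: sum.cartesian_product d_def)
      also have "\<dots> \<le> (\<Sum>n<N. (1/2) ^ n)"
        using K by (intro sum_mono small s) (auto simp: I_def)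
      also have "\<dots> \<le> 2" by (simp add: geometric_sum)
      finally show "sum (d s) K \<le> 2" .
    qed
  qed (auto simp: d_def)
  \<comment> \<open>Summability spreads from generators to all of \<open>G\<close>, since the
    coboundary of a product is the sum of that of \<open>g\<close> and a permuted copy of that of
    \<open>h\<close>.\<close>
  have b: "(\<lambda>i. (F (P g i) - F i)\<^sup>2) summable_on UNIV" if "g \<in> carrier G" for g
  proof -
    have SG: "S \<subseteq> carrier G" "m_inv G ` S = S" and "g \<in> generate G S"
      using S that by (auto simp: symmetric_generating_set_def)
    have b_S: "(\<lambda>i. (F (P s i) - F i)\<^sup>2) summable_on UNIV" if "s \<in> S" for s
      using summable_S[OF that] summable_on_reindex_bij_betw[OF \<iota>, of "d s"] d[of s] SG that by auto
    from \<open>g \<in> generate G S\<close> show ?thesis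
    proof (induction rule: generate.induct)
      case one
      show ?case by (simp add: P_one)
    next
      case (incl s)
      thus ?case by (rule b_S)
    next
      case (inv s)
      thus ?case using SG by (intro b_S) auto
    next
      case (eng g h)
      hence c: "g \<in> carrier G" "h \<in> carrier G"
        using generate_in_carrier[OF SG(1)] by auto
      have "(\<lambda>i. (F (P h (P g i)) - F (P g i))\<^sup>2) summable_on UNIV"
        using eng.IH(2) summable_on_reindex_bij_betw[OF P_bij[OF c(1)], of "\<lambda>i. (F (P h i) - F i)\<^sup>2"] by simp
      from square_summable_add(1)[OF this eng.IH(1)] show ?case
        by (simp add: P_mult[OF c])
    qed
  qed
  show ?thesis
  proof (rule coboundary_action[OF P_bij P_one P_mult b])
    fix C :: real
    obtain N :: nat where N: "C < real N" using reals_Archimedean2 by blast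
    define T where "T n = {h \<in> carrier G. f n h \<noteq> 0}" for n
    have T: "finite (T n)" "T n \<subseteq> carrier G" for n using fin by (auto simp: T_def)
    \<comment> \<open>If \<open>g\<close> maps a point \<open>k\<close> of \<open>T n\<close> to a
      point \<open>h\<close> of \<open>T n\<close>, then \<open>g = h \<otimes> inv k\<close>.
      Outside \<open>B\<close>, therefore, \<open>g\<close> moves each of the first \<open>N\<close>
      supports off itself.\<close>
    define B where "B = (\<Union>n<N. (\<lambda>(h, k). h \<otimes> inv k) ` (T n \<times> T n))"
    have "N \<le> (\<Sum>\<^sub>\<infinity>i. (F (P g i) - F i)\<^sup>2)" if g: "g \<in> carrier G" "g \<notin> B" for g
    proof -
      have zero: "f n (inv g \<otimes> h) = 0" if n: "n < N" "h \<in> T n" for n h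
      proof (rule ccontr)
        assume "f n (inv g \<otimes> h) \<noteq> 0"
        moreover have h: "h \<in> carrier G" using n T by blast
        ultimately have "inv g \<otimes> h \<in> T n" using g by (simp add: T_def)
        moreover have "g = h \<otimes> inv (inv g \<otimes> h)"
          using g h by (simp add: inv_mult_group m_assoc[symmetric])
        ultimately show False using g n by (force simp: B_def)
      qed
      \<comment> \<open>On \<open>T n\<close> the translated vector vanishes, so each of the
        \<open>N\<close> layers contributes at least the squared norm 1 of
        \<open>f n\<close>.\<close>
      have "real N = (\<Sum>n<N. \<Sum>h\<in>T n. (f n h)\<^sup>2)" by (simp add: T_def unit)
      also have "\<dots> = (\<Sum>n<N. \<Sum>h\<in>T n. d g (n, h))"
        by (intro sum.cong) (auto simp: d_def zero)
      also have "\<dots> = sum (d g) (Sigma {..<N} T)"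
        using T by (subst sum.Sigma) auto
      also have "\<dots> \<le> infsum (d g) I"
      proof (rule finite_sum_le_infsum)
        show "d g summable_on I"
          using b[OF g(1)] summable_on_reindex_bij_betw[OF \<iota>, of "d g"] by (simp add: d[OF g(1)])
        show "Sigma {..<N} T \<subseteq> I" using T by (force simp: I_def)
      qed (auto simp: d_def T)
      also have "\<dots> = (\<Sum>\<^sub>\<infinity>i. (F (P g i) - F i)\<^sup>2)"
        unfolding d[OF g(1)] by (rule infsum_reindex_bij_betw[OF \<iota>, symmetric])
      finally show ?thesis .
    qed
    hence "{g \<in> carrier G. (\<Sum>\<^sub>\<infinity>i. (F (P g i) - F i)\<^sup>2) \<le> C} \<subseteq> B" using N by fastforce
    moreover have "finite B" using T by (auto simp: B_def)
    ultimately show "finite {g \<in> carrier G. (\<Sum>\<^sub>\<infinity>i. (F (P g i) - F i)\<^sup>2) \<le> C}"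
      by (rule finite_subset)
  qed
qed

theorem theorem3:
  fixes G :: "('g, 'm) monoid_scheme"
    and S :: "'g set"
    and \<Phi> :: "'g \<Rightarrow> 'x::t2_space \<Rightarrow> 'x"
    and \<nu> :: "'x measure"
  assumes "group G"
    and "symmetric_generating_set G S"
    and "compact (UNIV :: 'x set)"
    and "action_by_homeomorphisms G \<Phi>"
    and "prob_space \<nu>" and "sets \<nu> = sets borel"
    and "measure_class_preserved G \<Phi> \<nu>"
    and "\<forall>s\<in>S. esssup \<nu> (rho \<Phi> \<nu> s) < \<infinity>"
    and "(\<integral>\<^sup>+x. rho_sup G \<Phi> \<nu> x \<partial>\<nu>) < \<infinity> \<or> (\<integral>\<^sup>+x. rho_inf G \<Phi> \<nu> x \<partial>\<nu>) > 0"
    and "topologically_amenable G S \<Phi>"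
  shows "has_proper_affine_isometric_action_on_hilbert_space G S"
proof -
  interpret quasi_invariant_action G \<Phi> \<nu>
    using assms(1,4-7) by (simp add: quasi_invariant_action_def quasi_invariant_action_axioms_def)
  have count: "countable (carrier G)" by (rule countable_carrier_of_finitely_generated[OF assms(1,2)])
  have S: "finite S" "S \<subseteq> carrier G"
    using assms(2) by (auto simp: symmetric_generating_set_def)
  obtain \<mu> where \<mu>: "prob_space \<mu>" "sets \<mu> = sets borel" "\<And>g. g \<in> carrier G \<Longrightarrow> distr \<mu> borel (\<Phi> g) = \<mu>"
    using invariant_prob_measure[OF count assms(9)] by blast
  have "\<exists>f. almost_invariant_vector G S ((1/2) ^ n) f" for n
    by (rule almost_invariant_vector_exists[OF assms(1) S assms(3,4) \<mu> assms(10)]) simp_all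
  hence "\<forall>n. \<exists>f. almost_invariant_vector G S ((1/2) ^ n) f" by blast
  from choice[OF this] obtain f where "\<And>n. almost_invariant_vector G S ((1/2) ^ n) (f n)"
    by blast
  thus ?thesis
    by (rule proper_action_from_almost_invariant_vectors[OF assms(1,2) count])
qed

end
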